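(* Let $n,r$ be positive integers with $n(r+1)$ even, and let $G=K_{n,\ldots,n,n+2}$ be the complete $(r+1)$-partite graph with $r$ parts of size $n$ and one part of size $n+2$. Then $\mathrm{def}(G)\leq nr+2$.
   Context: A complete $(r+1)$-partite graph has its vertex set partitioned into $r+1$ nonempty independent sets with every two vertices in different parts adjacent. For a proper edge-coloring $\alpha$ of a graph $G$ (with positive integer colors) and a vertex $v$, let $S(v,\alpha)$ be the set of colors on edges incident to $v$, and $\mathrm{def}(v,\alpha)=\max S(v,\alpha)-\min S(v,\alpha)-|S(v,\alpha)|+1$. The deficiency of $G$ is $\mathrm{def}(G)=\min_\alpha \sum_{v\in V(G)}\mathrm{def}(v,\alpha)$ over all proper edge-colorings $\alpha$ of $G$; equivalently, the minimum number of pendant edges whose attachment to $G$ yields a graph admitting an interval coloring (a proper edge-coloring with colors $1,\ldots,t$, all used, in which every vertex's color set is an integer interval). *)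

theory Defs
  imports Main "HOL-Library.Disjoint_Sets"
begin

text \<open>A simple graph is given by its vertex set \<open>V\<close> and its set \<open>E\<close> of two-element edges.\<close>

definition simple_graph :: "'a set \<Rightarrow> 'a set set \<Rightarrow> bool" where
  "simple_graph V E \<longleftrightarrow> finite V \<and> (\<forall>e\<in>E. e \<subseteq> V \<and> card e = 2)"

text \<open>Nonemptiness of the parts is part of \<open>partition_on\<close>.\<close>

definition complete_multipartite :: "'a set \<Rightarrow> 'a set set \<Rightarrow> 'a set set \<Rightarrow> bool" where
  "complete_multipartite V E P \<longleftrightarrow>
     simple_graph V E \<and> partition_on V P \<and>
     (\<forall>X\<in>P. \<forall>u\<in>X. \<forall>v\<in>X. {u, v} \<notin> E) \<and>
     (\<forall>X\<in>P. \<forall>Y\<in>P. X \<noteq> Y \<longrightarrow> (\<forall>u\<in>X. \<forall>v\<in>Y. {u, v} \<in> E))"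

text \<open>Only the values of a coloring on \<open>E\<close> matter.\<close>

definition proper_edge_coloring :: "'a set set \<Rightarrow> ('a set \<Rightarrow> nat) \<Rightarrow> bool" where
  "proper_edge_coloring E \<alpha> \<longleftrightarrow>
     (\<forall>e\<in>E. 0 < \<alpha> e) \<and>
     (\<forall>e\<in>E. \<forall>f\<in>E. e \<noteq> f \<and> e \<inter> f \<noteq> {} \<longrightarrow> \<alpha> e \<noteq> \<alpha> f)"

definition color_set :: "'a set set \<Rightarrow> ('a set \<Rightarrow> nat) \<Rightarrow> 'a \<Rightarrow> nat set" where
  "color_set E \<alpha> v = \<alpha> ` {e \<in> E. v \<in> e}"

text \<open>Isolated vertices get deficiency 0. The terms are ordered so that no subtraction
  truncates; see \<open>int_vertex_deficiency\<close> below.\<close>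

definition vertex_deficiency :: "'a set set \<Rightarrow> ('a set \<Rightarrow> nat) \<Rightarrow> 'a \<Rightarrow> nat" where
  "vertex_deficiency E \<alpha> v =
     (let S = color_set E \<alpha> v in
      if S = {} then 0 else Max S - Min S + 1 - card S)"

text \<open>The minimum exists for every simple graph; see \<open>deficiency_attained\<close> below.\<close>

definition deficiency :: "'a set \<Rightarrow> 'a set set \<Rightarrow> nat" where
  "deficiency V E =
     (LEAST d. \<exists>\<alpha>. proper_edge_coloring E \<alpha> \<and> d = (\<Sum>v\<in>V. vertex_deficiency E \<alpha> v))"

lemma simple_graph_finite_edges:
  assumes "simple_graph V E"
  shows "finite E"
proof (rule finite_subset)
  show "E \<subseteq> Pow V" using assms by (auto simp: simple_graph_def)
  show "finite (Pow V)" using assms by (simp add: simple_graph_def)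
qed

lemma int_vertex_deficiency:
  assumes "simple_graph V E" and "color_set E \<alpha> v \<noteq> {}"
  shows "int (vertex_deficiency E \<alpha> v) =
    int (Max (color_set E \<alpha> v)) - int (Min (color_set E \<alpha> v)) - int (card (color_set E \<alpha> v)) + 1"
proof -
  let ?S = "color_set E \<alpha> v"
  have fin: "finite ?S"
    using simple_graph_finite_edges[OF assms(1)] by (simp add: color_set_def)
  have le: "Min ?S \<le> Max ?S"
    using fin assms(2) by (meson Max_ge Min_in)
  have "?S \<subseteq> {Min ?S..Max ?S}"
    using fin by auto
  then have "card ?S \<le> card {Min ?S..Max ?S}"
    by (intro card_mono) auto
  then have "card ?S \<le> Max ?S - Min ?S + 1"
    using le by simp
  then show ?thesis
    using assms(2) le by (simp add: vertex_deficiency_def Let_def)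
qed

lemma proper_edge_coloring_exists:
  assumes "simple_graph V E"
  shows "\<exists>\<alpha>. proper_edge_coloring E \<alpha>"
proof -
  obtain f :: "'a set \<Rightarrow> nat" where "inj_on f E"
    using finite_imp_inj_to_nat_seg[OF simple_graph_finite_edges[OF assms]] by blast
  then have "proper_edge_coloring E (\<lambda>e. Suc (f e))"
    by (auto simp: proper_edge_coloring_def inj_on_def)
  then show ?thesis by blast
qed

lemma deficiency_attained:
  assumes "simple_graph V E"
  shows "\<exists>\<alpha>. proper_edge_coloring E \<alpha> \<and> deficiency V E = (\<Sum>v\<in>V. vertex_deficiency E \<alpha> v)"
  unfolding deficiency_def
  by (rule LeastI_ex) (use proper_edge_coloring_exists[OF assms] in blast)

lemma deficiency_le:
  assumes "proper_edge_coloring E \<alpha>"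
  shows "deficiency V E \<le> (\<Sum>v\<in>V. vertex_deficiency E \<alpha> v)"
  unfolding deficiency_def by (rule Least_le) (use assms in blast)

end

theory Submission
  imports Defs
begin

text \<open>For \<open>r = 1\<close> the coloring \<open>(s, q) \<mapsto> s + q + 1\<close> of the complete bipartite graph has deficiency
  \<open>0\<close>. For \<open>r \<ge> 2\<close> put \<open>N = n * r\<close> and number the vertices outside \<open>Q\<close> by \<open>0, \<dots>, N - 1\<close>
  so that the parts are the residue classes mod \<open>r\<close>. The Hamiltonian cycle through consecutive
  numbers is colored with the three colors \<open>N + 1, N + 2, N + 3\<close>. The remaining edges outside \<open>Q\<close> form
  a graph that is regular of even degree \<open>d = N - n - 2\<close> and properly \<open>N\<close>-colored by \<open>s + t mod N\<close>;
  Kempe swaps make all color classes have size \<open>d / 2\<close>. Now every vertex misses \<open>n + 2\<close> colors and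
  every color misses \<open>n + 2\<close> vertices, so by Koenig's theorem the missing colors can be distributed
  over the edges to \<open>Q\<close>. A vertex outside \<open>Q\<close> then has \<open>N + 2\<close> of \<open>N + 3\<close> colors, hence deficiency
  at most \<open>1\<close>, and a vertex of \<open>Q\<close> has all \<open>N\<close> colors \<open>1, \<dots>, N\<close>.\<close>

section \<open>Deficiency from an interval of colors\<close>

text \<open>A proper coloring is injective on the edges at \<open>v\<close>, so the number of colors
  at \<open>v\<close> is its degree, while \<open>Max - Min\<close> is at most \<open>u - l\<close>.
  The bound is the surplus of colors in \<open>{l..u}\<close> over the degree.\<close>

lemma vertex_deficiency_le:
  assumes "proper_edge_coloring E \<alpha>" and "finite E"
    and "\<And>e. e \<in> E \<Longrightarrow> v \<in> e \<Longrightarrow> \<alpha> e \<in> {l..u}"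
  shows "vertex_deficiency E \<alpha> v \<le> u + 1 - l - card {e \<in> E. v \<in> e}"
proof (cases "color_set E \<alpha> v = {}")
  case True
  then show ?thesis by (simp add: vertex_deficiency_def)
next
  case False
  let ?S = "color_set E \<alpha> v"
  have fin: "finite ?S" using assms(2) by (simp add: color_set_def)
  have sub: "?S \<subseteq> {l..u}" using assms(3) by (auto simp: color_set_def)
  have "Min ?S \<in> ?S" "Max ?S \<in> ?S" using fin False by auto
  then have "l \<le> Min ?S" "Max ?S \<le> u" using sub by (meson atLeastAtMost_iff subsetD)+
  moreover have "inj_on \<alpha> {e \<in> E. v \<in> e}"
    using assms(1) unfolding proper_edge_coloring_def inj_on_def by blast
  then have "card ?S = card {e \<in> E. v \<in> e}"
    by (simp add: color_set_def card_image)
  moreover have "Min ?S \<le> Max ?S" using fin False by simp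
  ultimately show ?thesis
    using False by (simp add: vertex_deficiency_def Let_def)
qed

section \<open>Kempe components and swaps\<close>

text \<open>Connectivity enters only through the inequality between vertices and edges that every
  connected graph satisfies. Among the sets with this inequality that contain \<open>e\<close>, one
  of greatest cardinality is closed, because an edge meeting it would add one edge and at most one
  new vertex. Such a \<open>K\<close> is a union of components, not necessarily a single
  one.\<close>

lemma exists_component:
  assumes "finite F" and "\<And>f. f \<in> F \<Longrightarrow> card f = 2" and "e \<in> F"
  shows "\<exists>K\<subseteq>F. e \<in> K \<and> card (\<Union>K) \<le> card K + 1 \<and> (\<forall>f\<in>F - K. f \<inter> \<Union>K = {})"
proof -
  let ?P = "\<lambda>K. K \<subseteq> F \<and> e \<in> K \<and> card (\<Union>K) \<le> card K + 1"
  have "?P {e}" using assms by simp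
  moreover have bd: "card K \<le> card F" if "?P K" for K
    using that assms(1) by (simp add: card_mono)
  ultimately have "\<exists>K. ?P K \<and> (\<forall>K'. ?P K' \<longrightarrow> card K' \<le> card K)"
    by (intro ex_has_greatest_nat[of ?P "{e}" card "Suc (card F)"]) (auto simp: less_Suc_eq_le)
  then obtain K where K: "?P K" and max: "\<And>K'. ?P K' \<Longrightarrow> card K' \<le> card K" by blast
  have "f \<inter> \<Union>K = {}" if f: "f \<in> F - K" for f
  proof (rule ccontr)
    assume ne: "f \<inter> \<Union>K \<noteq> {}"
    have finK: "finite K" using K assms(1) finite_subset by blast
    have finf: "finite f" using assms(2) f by (metis DiffD1 card.infinite zero_neq_numeral)
    have "card (f - \<Union>K) = card f - card (f \<inter> \<Union>K)"
      using finf by (simp add: card_Diff_subset_Int)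
    moreover have "card (f \<inter> \<Union>K) > 0" using ne finf by (simp add: card_gt_0_iff)
    ultimately have "card (f - \<Union>K) \<le> 1" using assms(2) f by simp
    moreover have "\<Union>(insert f K) = \<Union>K \<union> (f - \<Union>K)" by auto
    then have "card (\<Union>(insert f K)) \<le> card (\<Union>K) + card (f - \<Union>K)"
      by (metis card_Un_le)
    moreover have "card (insert f K) = card K + 1" using f finK by simp
    ultimately have "?P (insert f K)" using K f by auto
    then have "card (insert f K) \<le> card K" by (rule max)
    then show False using f finK by simp
  qed
  then show ?thesis using K by blast
qed

text \<open>Edges colored \<open>a\<close> or \<open>b\<close> that meet an edge of \<open>K\<close>
  lie in \<open>K\<close> themselves, so exchanging the two colors on \<open>K\<close> creates no
  conflict at its border.\<close>

lemma kempe_swap: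
  assumes "proper_edge_coloring E c" and "a > 0" and "b > 0"
    and "K \<subseteq> {e \<in> E. c e \<in> {a, b}}"
    and "\<forall>f\<in>{e \<in> E. c e \<in> {a, b}} - K. f \<inter> \<Union>K = {}"
  shows "proper_edge_coloring E (\<lambda>e. if e \<in> K then (if c e = a then b else a) else c e)"
    (is "proper_edge_coloring E ?c")
  unfolding proper_edge_coloring_def
proof (intro conjI ballI impI)
  fix e assume "e \<in> E"
  then show "0 < ?c e" using assms(1-3) by (auto simp: proper_edge_coloring_def)
next
  fix e f assume e: "e \<in> E" and f: "f \<in> E" and ef: "e \<noteq> f \<and> e \<inter> f \<noteq> {}"
  have ne: "c e \<noteq> c f" using assms(1) e f ef by (auto simp: proper_edge_coloring_def)
  have cl: "c y \<notin> {a, b}" if "x \<in> K" "y \<notin> K" "y \<in> E" "x \<inter> y \<noteq> {}" for x y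
    using that assms(5) by blast
  have ab: "c x \<in> {a, b}" if "x \<in> K" for x using that assms(4) by blast
  show "?c e \<noteq> ?c f"
    using ne cl[of e f] cl[of f e] ab[of e] ab[of f] e f ef by (auto simp: Int_commute)
qed

text \<open>With \<open>L = UNIV\<close> this counts all vertices covered by a color class, and with
  \<open>L\<close> one side of a bipartition it counts the covered vertices on that side.\<close>

lemma card_Union_matching:
  assumes "finite M" and "\<And>e. e \<in> M \<Longrightarrow> finite e"
    and "\<And>e f. e \<in> M \<Longrightarrow> f \<in> M \<Longrightarrow> e \<noteq> f \<Longrightarrow> e \<inter> f = {}"
  shows "card (\<Union>M \<inter> L) = (\<Sum>e\<in>M. card (e \<inter> L))"
proof -
  have "\<Union>M \<inter> L = (\<Union>e\<in>M. e \<inter> L)" by auto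
  moreover have "card (\<Union>e\<in>M. e \<inter> L) = (\<Sum>e\<in>M. card (e \<inter> L))"
    using assms by (intro card_UN_disjoint) blast+
  ultimately show ?thesis by simp
qed

text \<open>A component has excess at most one because it has at most one more vertex than edges;
  components with nonpositive excess may be discarded.\<close>

lemma exists_component_excess_one:
  assumes "finite A" and "finite B" and "A \<inter> B = {}"
    and "\<And>e. e \<in> A \<union> B \<Longrightarrow> card e = 2"
    and "\<And>e f. e \<in> A \<Longrightarrow> f \<in> A \<Longrightarrow> e \<noteq> f \<Longrightarrow> e \<inter> f = {}"
    and "card B + 1 < card A"
  shows "\<exists>K\<subseteq>A \<union> B. card (A \<inter> K) = card (B \<inter> K) + 1 \<and> (\<forall>f\<in>A \<union> B - K. f \<inter> \<Union>K = {})"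
  using assms
proof (induction "card (A \<union> B)" arbitrary: A B rule: less_induct)
  case less
  then obtain e where e: "e \<in> A" by fastforce
  obtain K where K: "K \<subseteq> A \<union> B" "e \<in> K" "card (\<Union>K) \<le> card K + 1"
      "\<forall>f\<in>A \<union> B - K. f \<inter> \<Union>K = {}"
    using exists_component[of "A \<union> B" e] less.prems e by auto
  have finK: "finite K" using K(1) less.prems(1,2) finite_subset by blast
  have fin: "finite x" if "x \<in> A \<union> B" for x
    using less.prems(4)[OF that] by (metis card.infinite zero_neq_numeral)
  \<comment> \<open>\<open>A\<close> is a matching, so its edges in \<open>K\<close> cover
    \<open>2 * card (A \<inter> K)\<close> vertices of \<open>\<Union>K\<close>. There are at most
    \<open>card K + 1\<close> vertices in \<open>\<Union>K\<close>, which bounds the excess by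
    one.\<close>
  have "card (\<Union>(A \<inter> K) \<inter> UNIV) = (\<Sum>e\<in>A \<inter> K. card (e \<inter> UNIV))"
    by (rule card_Union_matching) (use less.prems(1,5) fin in auto)
  also have "\<dots> = (\<Sum>e\<in>A \<inter> K. 2)"
    by (rule sum.cong) (use less.prems(4) in auto)
  finally have "card (\<Union>(A \<inter> K)) = 2 * card (A \<inter> K)" by simp
  moreover have "card (\<Union>(A \<inter> K)) \<le> card (\<Union>K)"
    using K(1) fin finK by (intro card_mono) auto
  moreover have "card K = card (A \<inter> K) + card (B \<inter> K)"
  proof -
    have "card ((A \<inter> K) \<union> (B \<inter> K)) = card (A \<inter> K) + card (B \<inter> K)"
      using finK less.prems(3) by (intro card_Un_disjoint) auto
    moreover have "(A \<inter> K) \<union> (B \<inter> K) = K" using K(1) by blast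
    ultimately show ?thesis by simp
  qed
  ultimately have le: "card (A \<inter> K) \<le> card (B \<inter> K) + 1" using K(3) by linarith
  show ?case
  proof (cases "card (A \<inter> K) = card (B \<inter> K) + 1")
    case True
    then show ?thesis using K by blast
  next
    case False
    \<comment> \<open>On \<open>K\<close> the excess of \<open>A\<close> over \<open>B\<close> is at
      most zero here, so what remains without \<open>K\<close> still has excess greater than
      one.\<close>
    have "card (A - K) = card A - card (A \<inter> K)" "card (B - K) = card B - card (B \<inter> K)"
      using less.prems(1,2) by (simp_all add: card_Diff_subset_Int)
    moreover have "card (A \<inter> K) \<le> card A" "card (B \<inter> K) \<le> card B"
      using less.prems(1,2) by (simp_all add: card_mono)
    ultimately have gt: "card (B - K) + 1 < card (A - K)"
      using le False less.prems(6) by linarith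
    have lt: "card ((A - K) \<union> (B - K)) < card (A \<union> B)"
      using less.prems(1,2) e K(2) by (intro psubset_card_mono) auto
    have "\<exists>K'\<subseteq>(A - K) \<union> (B - K). card ((A - K) \<inter> K') = card ((B - K) \<inter> K') + 1 \<and>
        (\<forall>f\<in>(A - K) \<union> (B - K) - K'. f \<inter> \<Union>K' = {})"
      by (rule less.hyps[OF lt]) (use gt less.prems in auto)
    then obtain K' where K': "K' \<subseteq> (A - K) \<union> (B - K)"
        "card ((A - K) \<inter> K') = card ((B - K) \<inter> K') + 1"
        "\<forall>f\<in>(A - K) \<union> (B - K) - K'. f \<inter> \<Union>K' = {}"
      by blast
    have "(A - K) \<inter> K' = A \<inter> K'" "(B - K) \<inter> K' = B \<inter> K'" using K'(1) by auto
    \<comment> \<open>\<open>K'\<close> is closed against the edges of \<open>K\<close> as well: its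
      own edges lie outside \<open>K\<close> and are therefore disjoint from
      \<open>\<Union>K\<close>.\<close>
    moreover have "\<forall>f\<in>A \<union> B - K'. f \<inter> \<Union>K' = {}"
      using K'(1,3) K(4) by blast
    moreover have "K' \<subseteq> A \<union> B" using K'(1) by blast
    ultimately show ?thesis using K'(2) by metis
  qed
qed

section \<open>Equalizing color classes\<close>

text \<open>Take a coloring that minimizes the sum of the squared class sizes. If class
  \<open>a\<close> had at least two edges more than class \<open>b\<close>, a swap on a closed set
  of excess one would move one unit from \<open>a\<close> to \<open>b\<close> and decrease that
  sum.\<close>

lemma exists_balanced_coloring:
  assumes "finite E" and "\<And>e. e \<in> E \<Longrightarrow> card e = 2"
    and "proper_edge_coloring E c0" and "c0 ` E \<subseteq> {1..N}"
  shows "\<exists>c. proper_edge_coloring E c \<and> c ` E \<subseteq> {1..N} \<and>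
    (\<forall>a\<in>{1..N}. \<forall>b\<in>{1..N}. card {e \<in> E. c e = a} \<le> card {e \<in> E. c e = b} + 1)"
proof -
  let ?s = "\<lambda>c a. card {e \<in> E. c e = a}"
  let ?P = "\<lambda>c. proper_edge_coloring E c \<and> c ` E \<subseteq> {1..N}"
  let ?m = "\<lambda>c. \<Sum>a\<in>{1..N}. (?s c a)\<^sup>2"
  obtain c where c: "?P c" and min: "\<And>c'. ?P c' \<Longrightarrow> ?m c \<le> ?m c'"
    using ex_has_least_nat[of ?P c0 ?m] assms(3,4) by blast
  have "?s c a \<le> ?s c b + 1" if a: "a \<in> {1..N}" and b: "b \<in> {1..N}" for a b
  proof (rule ccontr)
    assume gt: "\<not> ?thesis"
    then have ab: "a \<noteq> b" by auto
    let ?A = "{e \<in> E. c e = a}" and ?B = "{e \<in> E. c e = b}"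
    have AB: "{e \<in> E. c e \<in> {a, b}} = ?A \<union> ?B" by auto
    have "e \<inter> f = {}" if "e \<in> ?A" "f \<in> ?A" "e \<noteq> f" for e f
      using c that unfolding proper_edge_coloring_def by force
    then obtain K where K: "K \<subseteq> ?A \<union> ?B" "card (?A \<inter> K) = card (?B \<inter> K) + 1"
        "\<forall>f\<in>?A \<union> ?B - K. f \<inter> \<Union>K = {}"
      using exists_component_excess_one[of ?A ?B] assms(1,2) gt ab by fastforce
    define c' where "c' = (\<lambda>e. if e \<in> K then (if c e = a then b else a) else c e)"
    have "proper_edge_coloring E c'"
      unfolding c'_def using c a b K by (intro kempe_swap) (auto simp: AB)
    moreover have "c' ` E \<subseteq> {1..N}" using c a b by (auto simp: c'_def)
    ultimately have le: "?m c \<le> ?m c'" by (intro min) simp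
    have fin: "finite (X \<inter> K)" "finite (X - K)" if "X \<subseteq> E" for X
      using that assms(1) by (meson finite_Diff finite_Int finite_subset)+
    have "{e \<in> E. c' e = a} = (?A - K) \<union> (?B \<inter> K)" "{e \<in> E. c' e = b} = (?B - K) \<union> (?A \<inter> K)"
      using K(1) ab by (auto simp: c'_def split: if_splits)
    then have sa': "?s c' a = card (?A - K) + card (?B \<inter> K)"
      and sb': "?s c' b = card (?B - K) + card (?A \<inter> K)"
      using fin by (simp_all only:) (subst card_Un_disjoint; auto)+
    have s: "?s c a = card (?A - K) + card (?A \<inter> K)" "?s c b = card (?B - K) + card (?B \<inter> K)"
      using assms(1) card_Int_Diff[of ?A K] card_Int_Diff[of ?B K] by simp_all
    have other: "?s c' k = ?s c k" if "k \<notin> {a, b}" for k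
    proof -
      have "{e \<in> E. c' e = k} = {e \<in> E. c e = k}"
        using that K(1) by (auto simp: c'_def)
      then show ?thesis by simp
    qed
    have split: "(\<Sum>k\<in>{1..N}. g k) = g a + g b + (\<Sum>k\<in>{1..N} - {a, b}. g k)" for g :: "nat \<Rightarrow> nat"
    proof -
      have "(\<Sum>k\<in>{1..N}. g k) = sum g {a, b} + sum g ({1..N} - {a, b})"
        using a b by (metis add.commute empty_subsetI finite_atLeastAtMost insert_subset sum.subset_diff)
      then show ?thesis using ab by simp
    qed
    have "(\<Sum>k\<in>{1..N} - {a, b}. (?s c' k)\<^sup>2) = (\<Sum>k\<in>{1..N} - {a, b}. (?s c k)\<^sup>2)"
      by (rule sum.cong) (auto simp: other)
    with le have "(?s c a)\<^sup>2 + (?s c b)\<^sup>2 \<le> (?s c' a)\<^sup>2 + (?s c' b)\<^sup>2"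
      unfolding split by linarith
    \<comment> \<open>The sizes \<open>y + 2 + z\<close> and \<open>y\<close> become
      \<open>y + 1 + z\<close> and \<open>y + 1\<close>, so the sum of squares drops by
      \<open>2 * z + 2\<close>.\<close>
    moreover obtain y z where yz: "?s c b = y" "?s c a = y + 2 + z"
      using gt le_Suc_ex[of "?s c b + 2" "?s c a"] by auto
    moreover have "?s c' a = y + 1 + z" "?s c' b = y + 1"
      using s sa' sb' K(2) yz by linarith+
    ultimately show False by (simp add: power2_eq_square algebra_simps)
  qed
  then show ?thesis using c by blast
qed

section \<open>Koenig's edge-coloring theorem\<close>

text \<open>Induction on the edges: the new edge has an end \<open>u\<close> that misses a color
  \<open>a\<close> and an end \<open>v\<close> that misses a color \<open>b\<close>. If
  \<open>a\<close> occurs at \<open>v\<close>, swapping \<open>a\<close> and \<open>b\<close> on a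
  closed set that contains this edge and avoids \<open>u\<close> frees \<open>a\<close> at both
  ends.\<close>

lemma bipartite_edge_coloring:
  assumes "finite F" and "\<And>e. e \<in> F \<Longrightarrow> card (e \<inter> L) = 1 \<and> card (e - L) = 1"
    and "\<And>v. card {e \<in> F. v \<in> e} \<le> D"
  shows "\<exists>c. proper_edge_coloring F c \<and> c ` F \<subseteq> {1..D}"
  using assms
proof (induction F rule: finite_induct)
  case empty
  show ?case by (simp add: proper_edge_coloring_def)
next
  case (insert e F)
  have deg: "card {x \<in> F. v \<in> x} \<le> D" for v
    using insert.hyps(1) by (intro order_trans[OF card_mono insert.prems(2)[of v]]) auto
  obtain c where c: "proper_edge_coloring F c" "c ` F \<subseteq> {1..D}"
    using insert.IH insert.prems(1) deg by auto
  obtain u v where u: "e \<inter> L = {u}" and v: "e - L = {v}"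
    using insert.prems(1)[of e] by (auto simp: card_1_singleton_iff)
  then have e: "e = {u, v}" and uL: "u \<in> L" and vL: "v \<notin> L" by auto
  \<comment> \<open>Before \<open>e\<close> is added its ends have degree less than
    \<open>D\<close>, so some color is free at each of them.\<close>
  have free: "\<exists>a\<in>{1..D}. \<forall>x\<in>F. w \<in> x \<longrightarrow> c x \<noteq> a" if "w \<in> e" for w
  proof (rule ccontr)
    assume "\<not> ?thesis"
    then have "a \<in> c ` {x \<in> F. w \<in> x}" if "a \<in> {1..D}" for a
      using that by (auto simp: image_iff Bex_def)
    then have "{1..D} \<subseteq> c ` {x \<in> F. w \<in> x}" by (rule subsetI)
    then have "card {1..D} \<le> card {x \<in> F. w \<in> x}"
      using insert.hyps(1) by (intro surj_card_le) auto
    moreover have "{x \<in> insert e F. w \<in> x} = insert e {x \<in> F. w \<in> x}" using that by auto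
    then have "card {x \<in> insert e F. w \<in> x} = card {x \<in> F. w \<in> x} + 1"
      using insert.hyps by simp
    ultimately show False using insert.prems(2)[of w] by simp
  qed
  obtain a where a: "a \<in> {1..D}" "\<And>x. x \<in> F \<Longrightarrow> u \<in> x \<Longrightarrow> c x \<noteq> a"
    using free[of u] e by auto
  obtain b where b: "b \<in> {1..D}" "\<And>x. x \<in> F \<Longrightarrow> v \<in> x \<Longrightarrow> c x \<noteq> b"
    using free[of v] e by auto
  have "\<exists>c'. proper_edge_coloring F c' \<and> c' ` F \<subseteq> {1..D} \<and>
      (\<forall>x\<in>F. x \<inter> e \<noteq> {} \<longrightarrow> c' x \<noteq> a)"
  proof (cases "\<exists>x\<in>F. v \<in> x \<and> c x = a")
    case False
    then show ?thesis using c a e by (intro exI[of _ c]) auto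
  next
    case True
    then obtain x where x: "x \<in> F" "v \<in> x" "c x = a" by blast
    let ?F = "{x \<in> F. c x \<in> {a, b}}"
    have card2: "card y = 2" if "y \<in> F" for y
    proof -
      have *: "card (y \<inter> L) = 1" "card (y - L) = 1" using insert.prems(1) that by auto
      then have "finite (y \<inter> L)" "finite (y - L)" by (metis card.infinite zero_neq_one)+
      then have "card ((y \<inter> L) \<union> (y - L)) = card (y \<inter> L) + card (y - L)"
        by (intro card_Un_disjoint) auto
      then show ?thesis using * by (simp add: Int_Diff_Un)
    qed
    have fin: "finite y" if "y \<in> F" for y
      using card2[OF that] by (metis card.infinite zero_neq_numeral)
    obtain K where K: "K \<subseteq> ?F" "x \<in> K" "card (\<Union>K) \<le> card K + 1"
        "\<forall>f\<in>?F - K. f \<inter> \<Union>K = {}"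
      using exists_component[of ?F x] card2 insert.hyps(1) x by auto
    have finK: "finite K" using K(1) insert.hyps(1) by (simp add: finite_subset)
    have finUK: "finite (\<Union>K)" using K(1) finK fin by auto
    \<comment> \<open>A count replaces the usual parity argument along a path. The
      \<open>a\<close>-edges of \<open>K\<close> cover one vertex of \<open>L\<close> each and miss
      \<open>u\<close>; the \<open>b\<close>-edges cover one vertex outside \<open>L\<close> each
      and miss \<open>v\<close>. If \<open>u\<close> were in \<open>\<Union>K\<close>, there would
      be at least \<open>card K + 2\<close> vertices.\<close>
    have uK: "u \<notin> \<Union>K"
    proof
      assume uK: "u \<in> \<Union>K"
      define A where "A = {y \<in> K. c y = a}"
      define B where "B = {y \<in> K. c y = b}"
      have ab: "a \<noteq> b" using b(2) x by auto
      have "K = A \<union> B" "A \<inter> B = {}" using K(1) ab by (auto simp: A_def B_def)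
      moreover from this have "finite A" "finite B" using finK by (metis finite_Un)+
      ultimately have cK: "card K = card A + card B" by (metis card_Un_disjoint)
      have dis: "e \<inter> f = {}" if "e \<in> K" "f \<in> K" "e \<noteq> f" "c e = c f" for e f
        using c(1) that K(1) unfolding proper_edge_coloring_def by blast
      have "card (\<Union>A \<inter> L) = (\<Sum>y\<in>A. card (y \<inter> L))"
        using finK K(1) fin dis by (intro card_Union_matching) (auto simp: A_def)
      also have "\<dots> = (\<Sum>y\<in>A. 1)"
        by (rule sum.cong) (use K(1) insert.prems(1) in \<open>auto simp: A_def\<close>)
      finally have "card (\<Union>A \<inter> L) = card A" by simp
      moreover have "u \<notin> \<Union>A" using a(2) K(1) by (auto simp: A_def)
      moreover have "finite (\<Union>A \<inter> L)" using finUK by (rule rev_finite_subset) (auto simp: A_def)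
      ultimately have "card A + 1 = card (insert u (\<Union>A \<inter> L))" by simp
      also have "\<dots> \<le> card (\<Union>K \<inter> L)"
        using uK uL finUK by (intro card_mono) (auto simp: A_def)
      finally have 1: "card A + 1 \<le> card (\<Union>K \<inter> L)" .
      have "card (\<Union>B \<inter> - L) = (\<Sum>y\<in>B. card (y \<inter> - L))"
        using finK K(1) fin dis by (intro card_Union_matching) (auto simp: B_def)
      also have "\<dots> = (\<Sum>y\<in>B. 1)"
        by (rule sum.cong) (use K(1) insert.prems(1) in \<open>auto simp: B_def Diff_eq\<close>)
      finally have "card (\<Union>B \<inter> - L) = card B" by simp
      moreover have "v \<notin> \<Union>B" using b(2) K(1) by (auto simp: B_def)
      moreover have "finite (\<Union>B \<inter> - L)" using finUK by (rule rev_finite_subset) (auto simp: B_def)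
      ultimately have "card B + 1 = card (insert v (\<Union>B \<inter> - L))" by simp
      also have "\<dots> \<le> card (\<Union>K - L)"
        using vL finUK K(2) x(2) by (intro card_mono) (auto simp: B_def)
      finally have 2: "card B + 1 \<le> card (\<Union>K - L)" .
      have "card (\<Union>K) = card (\<Union>K \<inter> L) + card (\<Union>K - L)"
        using finUK by (rule card_Int_Diff)
      then show False using 1 2 cK K(3) by linarith
    qed
    define c' where "c' = (\<lambda>e. if e \<in> K then (if c e = a then b else a) else c e)"
    have "proper_edge_coloring F c'"
      unfolding c'_def using c a b K by (intro kempe_swap) auto
    moreover have "c' ` F \<subseteq> {1..D}" using c a b by (auto simp: c'_def)
    \<comment> \<open>The edges at \<open>u\<close> keep their colors because \<open>K\<close>
      avoids \<open>u\<close>. The edges of color \<open>a\<close> at \<open>v\<close> meet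
      \<open>x\<close>, hence lie in \<open>K\<close> and turn into color \<open>b\<close>; no edge
      at \<open>v\<close> had color \<open>b\<close> before.\<close>
    moreover have "c' y \<noteq> a" if y: "y \<in> F" "y \<inter> e \<noteq> {}" for y
    proof (cases "u \<in> y")
      case True
      then have "y \<notin> K" using uK by auto
      then show ?thesis using a(2) y True by (simp add: c'_def)
    next
      case False
      then have "v \<in> y" using y e by auto
      moreover have "y \<in> K" if "c y = a"
        using K(2,4) x(2) y(1) \<open>v \<in> y\<close> that by blast
      ultimately show ?thesis using b(2)[OF y(1)] K(1) b(2)[OF x(1)] x(2,3) by (auto simp: c'_def)
    qed
    ultimately show ?thesis by blast
  qed
  then obtain c' where c': "proper_edge_coloring F c'" "c' ` F \<subseteq> {1..D}"
      "\<And>x. x \<in> F \<Longrightarrow> x \<inter> e \<noteq> {} \<Longrightarrow> c' x \<noteq> a" by blast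
  have "proper_edge_coloring (insert e F) (c'(e := a))"
    unfolding proper_edge_coloring_def
  proof (intro conjI ballI impI)
    fix x assume "x \<in> insert e F"
    then show "0 < (c'(e := a)) x" using c'(1) a(1) by (auto simp: proper_edge_coloring_def)
  next
    fix x y assume xy: "x \<in> insert e F" "y \<in> insert e F" "x \<noteq> y \<and> x \<inter> y \<noteq> {}"
    show "(c'(e := a)) x \<noteq> (c'(e := a)) y"
    proof (cases "x = e \<or> y = e")
      case True
      then show ?thesis
        using xy c'(3)[of x] c'(3)[of y] by (auto simp: Int_commute)
    next
      case False
      then have "c' x \<noteq> c' y"
        using c'(1) xy unfolding proper_edge_coloring_def by blast
      then show ?thesis using False by simp
    qed
  qed
  moreover have "(c'(e := a)) ` insert e F \<subseteq> {1..D}" using c'(2) a(1) by auto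
  ultimately show ?case by blast
qed

section \<open>Joining a regular graph to an independent set\<close>

text \<open>Double counting gives \<open>card R = card W * h\<close>, so the average class size over
  \<open>card W\<close> colors is the integer \<open>h\<close>. Sizes that differ by at most one and
  have an integer average are all equal to it.\<close>

lemma regular_coloring_balanced:
  assumes "finite W" and "W \<noteq> {}" and R: "\<And>e. e \<in> R \<Longrightarrow> e \<subseteq> W \<and> card e = 2"
    and deg: "\<And>v. v \<in> W \<Longrightarrow> card {e \<in> R. v \<in> e} = 2 * h"
    and "proper_edge_coloring R c0" and "c0 ` R \<subseteq> {1..card W}"
  shows "\<exists>c. proper_edge_coloring R c \<and> c ` R \<subseteq> {1..card W} \<and>
    (\<forall>k\<in>{1..card W}. card {e \<in> R. c e = k} = h)"
proof -
  let ?N = "card W"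
  have finR: "finite R"
    by (rule finite_subset[of _ "Pow W"]) (use R assms(1) in auto)
  obtain c where c: "proper_edge_coloring R c" "c ` R \<subseteq> {1..?N}"
    and bal: "\<forall>a\<in>{1..?N}. \<forall>b\<in>{1..?N}. card {e \<in> R. c e = a} \<le> card {e \<in> R. c e = b} + 1"
    using exists_balanced_coloring[OF finR conjunct2[OF R] assms(5,6)] by blast
  define s where "s = (\<lambda>k. card {e \<in> R. c e = k})"
  have "(\<Sum>v\<in>W. card {e \<in> R. v \<in> e}) = 2 * card R"
  proof (rule sum_multicount[OF assms(1) finR], rule ballI)
    fix e assume "e \<in> R"
    then have "{v \<in> W. v \<in> e} = e" using R by blast
    then show "card {v \<in> W. v \<in> e} = 2" using R \<open>e \<in> R\<close> by simp
  qed
  moreover have "(\<Sum>v\<in>W. card {e \<in> R. v \<in> e}) = (\<Sum>v\<in>W. 2 * h)"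
    by (rule sum.cong) (auto simp: deg)
  ultimately have cR: "card R = ?N * h" by simp
  have "(\<Sum>k\<in>{1..?N}. card {e \<in> R. c e = k}) = 1 * card R"
  proof (rule sum_multicount[OF _ finR], simp, rule ballI)
    fix e assume "e \<in> R"
    then have "{k \<in> {1..?N}. c e = k} = {c e}" using c(2) by auto
    then show "card {k \<in> {1..?N}. c e = k} = 1" by simp
  qed
  then have tot: "(\<Sum>k\<in>{1..?N}. s k) = (\<Sum>k\<in>{1..?N}. h)" using cR by (simp add: s_def)
  have "s k = h" if k: "k \<in> {1..?N}" for k
  proof (rule ccontr)
    assume "s k \<noteq> h"
    then consider "s k < h" | "s k > h" by linarith
    then show False
    proof cases
      case 1
      then have "\<forall>b\<in>{1..?N}. s b \<le> h" using bal k by (fastforce simp: s_def)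
      then have "(\<Sum>k\<in>{1..?N}. s k) < (\<Sum>k\<in>{1..?N}. h)"
        using 1 k by (intro sum_strict_mono_ex1) auto
      then show False using tot by simp
    next
      case 2
      then have "\<forall>b\<in>{1..?N}. h \<le> s b" using bal k by (fastforce simp: s_def)
      then have "(\<Sum>k\<in>{1..?N}. h) < (\<Sum>k\<in>{1..?N}. s k)"
        using 2 k by (intro sum_strict_mono_ex1) auto
      then show False using tot by simp
    qed
  qed
  then show ?thesis using c unfolding s_def by blast
qed

text \<open>In a balanced coloring the graph joining each vertex to its missing colors is regular;
  its edge-colorings by \<open>S\<close> are the ways to color the edges between \<open>W\<close> and \<open>S\<close>.\<close>

lemma regular_coloring_extends_to_join:
  assumes "finite W" and "W \<noteq> {}" and R: "\<And>e. e \<in> R \<Longrightarrow> e \<subseteq> W \<and> card e = 2"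
    and deg: "\<And>v. v \<in> W \<Longrightarrow> card {e \<in> R. v \<in> e} = 2 * h"
    and "proper_edge_coloring R c0" and "c0 ` R \<subseteq> {1..card W}"
    and "finite S" and "W \<inter> S = {}" and card: "card W = card S + 2 * h"
  shows "\<exists>c. proper_edge_coloring (R \<union> {{v, q} |v q. v \<in> W \<and> q \<in> S}) c \<and>
    c ` (R \<union> {{v, q} |v q. v \<in> W \<and> q \<in> S}) \<subseteq> {1..card W}"
proof -
  let ?N = "card W"
  obtain c where c: "proper_edge_coloring R c" "c ` R \<subseteq> {1..?N}"
    and cls: "\<forall>k\<in>{1..?N}. card {e \<in> R. c e = k} = h"
    using regular_coloring_balanced[OF assms(1-6)] by metis
  have finR: "finite R"
    by (rule finite_subset[of _ "Pow W"]) (use R assms(1) in auto)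
  define M where "M = (\<lambda>v. {1..?N} - color_set R c v)"
  \<comment> \<open>The sum type keeps the vertices of \<open>W\<close> and the colors apart, so
    that \<open>range Inl\<close> is one side of a bipartition.\<close>
  define F where "F = {{Inl v, Inr k} |v k. v \<in> W \<and> k \<in> M v}"
  have cardM: "card (M v) = card S" if "v \<in> W" for v
  proof -
    have "inj_on c {e \<in> R. v \<in> e}"
      using c(1) unfolding proper_edge_coloring_def inj_on_def by blast
    then have "card (color_set R c v) = 2 * h"
      using deg[OF that] by (simp add: color_set_def card_image)
    moreover have "color_set R c v \<subseteq> {1..?N}" using c(2) by (auto simp: color_set_def)
    ultimately have "card (M v) = ?N - 2 * h"
      using finR by (simp add: M_def color_set_def card_Diff_subset)
    then show ?thesis using card by simp
  qed
  \<comment> \<open>Color class \<open>k\<close> is a matching of \<open>h\<close> edges and covers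
    \<open>2 * h\<close> vertices, which leaves \<open>card S\<close> vertices that miss
    \<open>k\<close>.\<close>
  have cardW: "card {v \<in> W. k \<in> M v} = card S" if "k \<in> {1..?N}" for k
  proof -
    let ?C = "{e \<in> R. c e = k}"
    have "card (\<Union>?C \<inter> UNIV) = (\<Sum>e\<in>?C. card (e \<inter> UNIV))"
    proof (rule card_Union_matching)
      show "finite e" if "e \<in> ?C" for e
        using that R assms(1) by (auto intro: finite_subset)
      show "e \<inter> f = {}" if "e \<in> ?C" "f \<in> ?C" "e \<noteq> f" for e f
      proof -
        have "c e = c f" "e \<in> R" "f \<in> R" using that by auto
        then show ?thesis using c(1) that(3) unfolding proper_edge_coloring_def by metis
      qed
    qed (use finR in simp)
    also have "\<dots> = (\<Sum>e\<in>?C. 2)" by (rule sum.cong) (use R in auto)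
    finally have "card (\<Union>?C) = 2 * h" using cls that by simp
    moreover have "\<Union>?C \<subseteq> W" using R by blast
    ultimately have "card (W - \<Union>?C) = ?N - 2 * h"
      using assms(1) by (simp add: card_Diff_subset finite_subset)
    moreover have "{v \<in> W. k \<in> M v} = W - \<Union>?C"
      using that by (auto simp: M_def color_set_def)
    ultimately show ?thesis using card by simp
  qed
  have degl: "{e \<in> F. Inl v \<in> e} = (\<lambda>k. {Inl v, Inr k}) ` M v" if "v \<in> W" for v
    using that by (auto simp: F_def)
  have degr: "{e \<in> F. Inr k \<in> e} = (\<lambda>v. {Inl v, Inr k}) ` {v \<in> W. k \<in> M v}" for k
    by (auto simp: F_def)
  have injl: "inj_on (\<lambda>k :: nat. {Inl v, Inr k}) A" and injr: "inj_on (\<lambda>v :: 'a. {Inl v, Inr k}) B"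
    for v :: 'a and k :: nat and A B
    by (auto simp: inj_on_def doubleton_eq_iff)
  have finM: "finite (M v)" for v by (simp add: M_def)
  have "F = (\<Union>v\<in>W. (\<lambda>k. {Inl v, Inr k}) ` M v)" by (auto simp: F_def)
  then have finF: "finite F" using assms(1) finM by simp
  have "\<exists>\<phi>. proper_edge_coloring F \<phi> \<and> \<phi> ` F \<subseteq> {1..card S}"
  proof (rule bipartite_edge_coloring[OF finF, of "range Inl"])
    fix e assume "e \<in> F"
    then obtain v k where "e = {Inl v, Inr k}" by (auto simp: F_def)
    then have "e \<inter> range Inl = {Inl v}" "e - range Inl = {Inr k}" by auto
    then show "card (e \<inter> range Inl) = 1 \<and> card (e - range Inl) = 1" by simp
  next
    fix x :: "'a + nat"
    show "card {e \<in> F. x \<in> e} \<le> card S"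
    proof (cases x)
      case (Inl v)
      show ?thesis
      proof (cases "v \<in> W")
        case True
        then show ?thesis using cardM injl degl Inl by (simp add: card_image)
      next
        case False
        then have "{e \<in> F. x \<in> e} = {}" using Inl by (auto simp: F_def)
        then show ?thesis by (simp only: card.empty le0)
      qed
    next
      case (Inr k)
      show ?thesis
      proof (cases "k \<in> {1..?N}")
        case True
        then show ?thesis using cardW injr degr Inr by (simp add: card_image)
      next
        case False
        then have "{e \<in> F. x \<in> e} = {}" using Inr by (auto simp: F_def M_def)
        then show ?thesis by (simp only: card.empty le0)
      qed
    qed
  qed
  then obtain \<phi> where \<phi>: "proper_edge_coloring F \<phi>" "\<phi> ` F \<subseteq> {1..card S}" by blast
  obtain \<beta> where \<beta>: "bij_betw \<beta> S {1..card S}"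
    using finite_same_card_bij[OF assms(7), of "{1..card S}"] by auto
  \<comment> \<open>\<open>Inl v\<close> has degree \<open>card S\<close> in \<open>F\<close>, so
    all \<open>card S\<close> colors of \<open>\<phi>\<close> occur there. The edge of color
    \<open>\<beta> q\<close> leads to the missing color that the edge from \<open>v\<close> to
    \<open>q\<close> will receive.\<close>
  have "\<exists>k. k \<in> M v \<and> \<phi> {Inl v, Inr k} = \<beta> q" if v: "v \<in> W" and q: "q \<in> S" for v q
  proof -
    let ?D = "{e \<in> F. Inl v \<in> e}"
    have "inj_on \<phi> ?D"
      using \<phi>(1) unfolding proper_edge_coloring_def inj_on_def by blast
    then have "card (\<phi> ` ?D) = card S"
      using cardM[OF v] injl by (simp add: card_image degl[OF v])
    moreover have "\<phi> ` ?D \<subseteq> {1..card S}" using \<phi>(2) by auto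
    ultimately have "\<phi> ` ?D = {1..card S}" by (simp add: card_subset_eq)
    moreover have "\<beta> q \<in> {1..card S}" using \<beta> q by (rule bij_betw_apply)
    ultimately have "\<beta> q \<in> \<phi> ` ?D" by simp
    then show ?thesis unfolding degl[OF v] by auto
  qed
  then obtain \<kappa> where \<kappa>: "\<And>v q. v \<in> W \<Longrightarrow> q \<in> S \<Longrightarrow> \<kappa> v q \<in> M v \<and> \<phi> {Inl v, Inr (\<kappa> v q)} = \<beta> q"
    by metis
  \<comment> \<open>Injectivity of \<open>\<kappa>\<close> in \<open>q\<close> makes the extended
    coloring proper at \<open>v\<close>. Injectivity in \<open>v\<close>, which comes from
    properness of \<open>\<phi>\<close> at \<open>Inr k\<close>, makes it proper at
    \<open>q\<close>.\<close>
  have \<kappa>q: "q = q'" if "v \<in> W" "q \<in> S" "q' \<in> S" "\<kappa> v q = \<kappa> v q'" for v q q'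
    using \<kappa>[OF that(1,2)] \<kappa>[OF that(1,3)] that(4)
    by (intro inj_onD[OF bij_betw_imp_inj_on[OF \<beta>] _ that(2,3)]) simp
  have \<kappa>v: "v = v'" if "v \<in> W" "v' \<in> W" "q \<in> S" "\<kappa> v q = \<kappa> v' q" for v v' q
  proof (rule ccontr)
    assume "v \<noteq> v'"
    let ?e = "{Inl v, Inr (\<kappa> v q)}" and ?f = "{Inl v', Inr (\<kappa> v q)}"
    have "?e \<noteq> ?f" using \<open>v \<noteq> v'\<close> by (auto simp: doubleton_eq_iff)
    moreover have "?e \<in> F" "?f \<in> F" using \<kappa>[of v q] \<kappa>[of v' q] that by (auto simp: F_def)
    moreover have "?e \<inter> ?f \<noteq> {}" by simp
    ultimately have "\<phi> ?e \<noteq> \<phi> ?f"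
      using \<phi>(1) unfolding proper_edge_coloring_def by metis
    then show False using \<kappa>[of v q] \<kappa>[of v' q] that by simp
  qed
  \<comment> \<open>\<open>the_elem\<close> recovers the end in \<open>W\<close> and the end in
    \<open>S\<close> of a joining edge.\<close>
  define c' where "c' = (\<lambda>e. if e \<in> R then c e else \<kappa> (the_elem (e \<inter> W)) (the_elem (e \<inter> S)))"
  have notR: "{v, q} \<notin> R" if "q \<in> S" for v q using that R assms(8) by blast
  have c'J: "c' {v, q} = \<kappa> v q" if "v \<in> W" "q \<in> S" for v q
  proof -
    have "{v, q} \<inter> W = {v}" "{v, q} \<inter> S = {q}" using that assms(8) by auto
    then show ?thesis using notR[OF that(2)] by (simp add: c'_def)
  qed
  have c'R: "c' e = c e" if "e \<in> R" for e using that by (simp add: c'_def)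
  let ?J = "{{v, q} |v q. v \<in> W \<and> q \<in> S}"
  have RJ: "c e \<noteq> \<kappa> v q" if "e \<in> R" "v \<in> W" "q \<in> S" "e \<inter> {v, q} \<noteq> {}" for e v q
  proof -
    have "v \<in> e" using that R assms(8) by blast
    then have "c e \<in> color_set R c v" using that(1) by (simp add: color_set_def)
    then show ?thesis using \<kappa>[OF that(2,3)] by (auto simp: M_def)
  qed
  have "proper_edge_coloring (R \<union> ?J) c'"
    unfolding proper_edge_coloring_def
  proof (intro conjI ballI impI)
    fix e assume "e \<in> R \<union> ?J"
    then show "0 < c' e"
    proof
      assume "e \<in> R"
      then show ?thesis using c(1) c'R by (simp add: proper_edge_coloring_def)
    next
      assume "e \<in> ?J"
      then obtain v q where "e = {v, q}" "v \<in> W" "q \<in> S" by blast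
      then show ?thesis using \<kappa>[of v q] c'J by (simp add: M_def)
    qed
  next
    fix e f assume e: "e \<in> R \<union> ?J" and f: "f \<in> R \<union> ?J" and ef: "e \<noteq> f \<and> e \<inter> f \<noteq> {}"
    show "c' e \<noteq> c' f"
    proof (cases "e \<in> R")
      case eR: True
      show ?thesis
      proof (cases "f \<in> R")
        case True
        then show ?thesis using eR c(1) ef c'R[OF eR] c'R[OF True] unfolding proper_edge_coloring_def by auto
      next
        case False
        then obtain v q where vq: "f = {v, q}" "v \<in> W" "q \<in> S" using f by blast
        then show ?thesis using RJ[OF eR vq(2,3)] ef c'R[OF eR] c'J[OF vq(2,3)] by simp
      qed
    next
      case False
      then obtain v q where vq: "e = {v, q}" "v \<in> W" "q \<in> S" using e by blast
      show ?thesis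
      proof (cases "f \<in> R")
        case True
        have "f \<inter> {v, q} \<noteq> {}" using ef vq(1) by blast
        then show ?thesis using RJ[OF True vq(2,3)] vq(1) c'R[OF True] c'J[OF vq(2,3)] by simp
      next
        case False
        then obtain v' q' where vq': "f = {v', q'}" "v' \<in> W" "q' \<in> S" using f by blast
        then have "v = v' \<or> q = q'" "v \<noteq> v' \<or> q \<noteq> q'" using ef vq assms(8) by auto
        then show ?thesis
          using \<kappa>q[of v q q'] \<kappa>v[of v v' q] vq vq' c'J[OF vq(2,3)] c'J[OF vq'(2,3)] by auto
      qed
    qed
  qed
  moreover have "c' e \<in> {1..?N}" if e: "e \<in> R \<union> ?J" for e
  proof (cases "e \<in> R")
    case True
    then show ?thesis using c(2) c'R[OF True] by auto
  next
    case False
    then obtain v q where "e = {v, q}" "v \<in> W" "q \<in> S" using e by blast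
    then show ?thesis using \<kappa>[of v q] c'J by (simp add: M_def)
  qed
  then have "c' ` (R \<union> ?J) \<subseteq> {1..?N}" by (rule image_subsetI)
  ultimately show ?thesis by (intro exI[of _ c'] conjI)
qed

section \<open>A numbered copy of the graph and its coloring\<close>

lemma card_residue_class:
  assumes "c < (r :: nat)"
  shows "card {t. t < n * r \<and> t mod r = c} = n"
proof -
  have "{t. t < n * r \<and> t mod r = c} = (\<lambda>i. i * r + c) ` {..<n}"
  proof (intro equalityI subsetI)
    fix t assume t: "t \<in> {t. t < n * r \<and> t mod r = c}"
    then have "t = (t div r) * r + c" by (metis (mono_tags) div_mult_mod_eq mem_Collect_eq)
    moreover have "t div r < n" using t by (simp add: less_mult_imp_div_less)
    ultimately show "t \<in> (\<lambda>i. i * r + c) ` {..<n}" by blast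
  next
    fix t assume "t \<in> (\<lambda>i. i * r + c) ` {..<n}"
    then obtain i where i: "i < n" "t = i * r + c" by blast
    have "Suc i * r \<le> n * r" using i(1) by (intro mult_le_mono) auto
    then show "t \<in> {t. t < n * r \<and> t mod r = c}" using i assms by simp
  qed
  moreover have "inj_on (\<lambda>i. i * r + c) {..<n}" using assms by (auto simp: inj_on_def)
  ultimately show ?thesis by (simp add: card_image)
qed

text \<open>Residue classes rather than blocks serve as parts because consecutive numbers are then
  adjacent for \<open>r \<ge> 2\<close>, which makes a Hamiltonian cycle explicit.\<close>

definition inner_edges :: "nat \<Rightarrow> nat \<Rightarrow> nat set set" where
  "inner_edges n r = {{s, t} |s t. s < n * r \<and> t < n * r \<and> s mod r \<noteq> t mod r}"

text \<open>The numbers from \<open>n * r\<close> on stand for \<open>Q\<close>. Membership in place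
  of inequalities gives the form of the joining edges in
  \<open>regular_coloring_extends_to_join\<close>.\<close>

definition outer_edges :: "nat \<Rightarrow> nat \<Rightarrow> nat set set" where
  "outer_edges n r = {{s, q} |s q. s \<in> {..<n * r} \<and> q \<in> {n * r..<n * r + n + 2}}"

definition cyclic_adjacent :: "nat \<Rightarrow> nat \<Rightarrow> nat \<Rightarrow> bool" where
  "cyclic_adjacent N s t \<longleftrightarrow>
     t = Suc s \<or> s = Suc t \<or> s = 0 \<and> Suc t = N \<or> t = 0 \<and> Suc s = N"

definition cycle_edges :: "nat \<Rightarrow> nat set set" where
  "cycle_edges N = {{s, t} |s t. s < N \<and> t < N \<and> cyclic_adjacent N s t}"

text \<open>Path edges alternate between two colors by the parity of their lower end; the closing
  edge gets a third color since \<open>N\<close> may be odd. For \<open>N \<ge> 3\<close> the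
  closing edge is not a path edge. All colors exceed \<open>N\<close>, which leaves \<open>1\<close>
  to \<open>N\<close> for the other edges.\<close>

lemma cycle_edges_coloring:
  assumes "N \<ge> 3"
  shows "\<exists>c. proper_edge_coloring (cycle_edges N) c \<and> c ` cycle_edges N \<subseteq> {N + 1..N + 3}"
proof -
  define c where "c = (\<lambda>e :: nat set. if e = {0, N - 1} then N + 3 else N + 1 + Min e mod 2)"
  have E: "cycle_edges N = insert {0, N - 1} ((\<lambda>t. {t, Suc t}) ` {t. Suc t < N})"
  proof (intro equalityI subsetI)
    fix e assume "e \<in> cycle_edges N"
    then obtain s t where st: "e = {s, t}" "s < N" "t < N" "cyclic_adjacent N s t"
      unfolding cycle_edges_def by blast
    then consider "t = Suc s" | "s = Suc t" | "s = 0" "t = N - 1" | "t = 0" "s = N - 1"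
      by (auto simp: cyclic_adjacent_def)
    then show "e \<in> insert {0, N - 1} ((\<lambda>t. {t, Suc t}) ` {t. Suc t < N})"
      by cases (use st in \<open>auto simp: insert_commute\<close>)
  next
    fix e assume "e \<in> insert {0, N - 1} ((\<lambda>t. {t, Suc t}) ` {t. Suc t < N})"
    then consider "e = {0, N - 1}" | t where "e = {t, Suc t}" "Suc t < N" by blast
    then obtain s t where "e = {s, t}" "s < N" "t < N" "cyclic_adjacent N s t"
    proof cases
      case 1
      then show ?thesis using that[of 0 "N - 1"] assms by (simp add: cyclic_adjacent_def)
    next
      case (2 t)
      then show ?thesis using that[of t "Suc t"] by (simp add: cyclic_adjacent_def)
    qed
    then show "e \<in> cycle_edges N"
      unfolding cycle_edges_def by (intro CollectI exI[of _ s] exI[of _ t]) simp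
  qed
  have ne: "{t, Suc t} \<noteq> {0, N - 1}" for t using assms by (auto simp: doubleton_eq_iff)
  have cs: "c {t, Suc t} = N + 1 + t mod 2" for t using ne[of t] by (simp add: c_def)
  have c0: "c {0, N - 1} = N + 3" by (simp add: c_def)
  have "proper_edge_coloring (cycle_edges N) c"
    unfolding proper_edge_coloring_def
  proof (intro conjI ballI impI)
    fix e show "0 < c e" by (simp add: c_def)
  next
    fix e f assume e: "e \<in> cycle_edges N" and f: "f \<in> cycle_edges N"
      and ef: "e \<noteq> f \<and> e \<inter> f \<noteq> {}"
    show "c e \<noteq> c f"
    proof (cases "e = {0, N - 1} \<or> f = {0, N - 1}")
      case True
      moreover have "c x \<noteq> c {0, N - 1}" if x: "x \<in> cycle_edges N" "x \<noteq> {0, N - 1}" for x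
      proof -
        obtain t where "x = {t, Suc t}" using x unfolding E by blast
        then show ?thesis by (simp only: cs c0)
      qed
      ultimately show ?thesis using e f ef by metis
    next
      case False
      then obtain s t where st: "e = {s, Suc s}" "f = {t, Suc t}" using e f E by auto
      then have "s = Suc t \<or> t = Suc s" using ef by auto
      then have "s mod 2 \<noteq> t mod 2" by presburger
      then show ?thesis unfolding st cs by simp
    qed
  qed
  moreover have "c ` cycle_edges N \<subseteq> {N + 1..N + 3}"
  proof
    fix k assume "k \<in> c ` cycle_edges N"
    then obtain e where e: "k = c e" "e \<in> cycle_edges N" by blast
    show "k \<in> {N + 1..N + 3}" by (simp add: e(1) c_def)
  qed
  ultimately show ?thesis by blast
qed

lemma canonical_coloring:
  assumes "n > 0" and "r \<ge> 2" and "even (n * (r + 1))"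
  shows "\<exists>\<alpha>. proper_edge_coloring (inner_edges n r \<union> outer_edges n r) \<alpha> \<and>
    \<alpha> ` inner_edges n r \<subseteq> {1..n * r + 3} \<and> \<alpha> ` outer_edges n r \<subseteq> {1..n * r}"
proof -
  define N where "N = n * r"
  \<comment> \<open>Here \<open>Suc r'\<close> is \<open>r - 1\<close>. As
    \<open>n * (r + 1)\<close> and \<open>n * (r - 1)\<close> differ by \<open>2 * n\<close>, the
    latter is even; it is also positive, so it has the form \<open>2 + 2 * h\<close>.\<close>
  obtain r' where r': "r = Suc (Suc r')" using assms(2) by (metis add_2_eq_Suc le_Suc_ex)
  have "n * (r + 1) = n * Suc r' + 2 * n" by (simp add: r')
  then have "even (n * Suc r')" using assms(3) by (metis dvd_triv_left even_add)
  then obtain k where "n * Suc r' = 2 * k" by (rule evenE)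
  moreover from this have "k \<noteq> 0" using assms(1) by (metis mult_0_right mult_is_0 nat.distinct(1) neq0_conv)
  ultimately obtain h where h: "n * Suc r' = 2 + 2 * h" by (cases k) auto
  \<comment> \<open>This is the size condition for joining a \<open>2 * h\<close>-regular graph on
    \<open>N\<close> vertices to the \<open>n + 2\<close> vertices of \<open>Q\<close>.\<close>
  then have Nh: "N = (n + 2) + 2 * h" by (simp add: N_def r' algebra_simps)
  then have N3: "N \<ge> 3" using assms(1) by simp
  define R where "R = inner_edges n r - cycle_edges N"
  \<comment> \<open>Consecutive numbers differ mod \<open>r\<close> because
    \<open>r \<ge> 2\<close>. For the closing pair, \<open>r\<close> divides \<open>N\<close>, so
    \<open>N - 1\<close> is not congruent to \<open>0\<close>.\<close>
  have cyc: "s mod r \<noteq> t mod r" if "cyclic_adjacent N s t" for s t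
  proof -
    have *: "Suc x mod r \<noteq> x mod r" for x
      using assms(2) by (simp add: mod_Suc)
    have "Suc x mod r = 0" if "Suc x = N" for x using that by (simp add: N_def)
    then have "x mod r \<noteq> 0" if "Suc x = N" for x using that * by metis
    then show ?thesis using that * by (auto simp: cyclic_adjacent_def) metis+
  qed
  have sym: "cyclic_adjacent N s t \<longleftrightarrow> cyclic_adjacent N t s" for s t
    by (auto simp: cyclic_adjacent_def)
  have XI: "cycle_edges N \<subseteq> inner_edges n r"
    using cyc by (fastforce simp: cycle_edges_def inner_edges_def N_def)
  have Req: "{s, t} \<in> R \<longleftrightarrow> s < N \<and> t < N \<and> s mod r \<noteq> t mod r \<and> \<not> cyclic_adjacent N s t" for s t
    using sym by (auto simp: R_def cycle_edges_def inner_edges_def N_def doubleton_eq_iff)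
  have Rform: "\<exists>s t. e = {s, t} \<and> s < N \<and> t < N \<and> s \<noteq> t" if "e \<in> R" for e
    using that by (auto simp: R_def inner_edges_def N_def)
  have Rvform: "\<exists>t. e = {v, t}" if "e \<in> R" "v \<in> e" for e v
    using Rform[OF that(1)] that(2) by (metis doubleton_eq_iff insertE singletonD)
  \<comment> \<open>A vertex is not joined to the \<open>n\<close> members of its own class, itself
    included, nor to its two cycle neighbors, which lie in other classes.\<close>
  have deg: "card {e \<in> R. v \<in> e} = 2 * h" if v: "v \<in> {..<N}" for v
  proof -
    let ?A = "{t. t < N \<and> t mod r = v mod r}" and ?B = "{t. t < N \<and> cyclic_adjacent N v t}"
    have "{e \<in> R. v \<in> e} = (\<lambda>t. {v, t}) ` ({..<N} - (?A \<union> ?B))"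
    proof (intro equalityI subsetI)
      fix e assume e: "e \<in> {e \<in> R. v \<in> e}"
      then obtain t where t: "e = {v, t}" using Rvform by blast
      then have "t \<in> {..<N} - (?A \<union> ?B)" using e Req[of v t] by auto
      then show "e \<in> (\<lambda>t. {v, t}) ` ({..<N} - (?A \<union> ?B))" using t by blast
    next
      fix e assume "e \<in> (\<lambda>t. {v, t}) ` ({..<N} - (?A \<union> ?B))"
      then obtain t where "e = {v, t}" "t \<in> {..<N} - (?A \<union> ?B)" by blast
      then show "e \<in> {e \<in> R. v \<in> e}" using v Req[of v t] by auto
    qed
    moreover have "inj_on (\<lambda>t. {v, t}) X" for X by (auto simp: inj_on_def doubleton_eq_iff)
    ultimately have "card {e \<in> R. v \<in> e} = card ({..<N} - (?A \<union> ?B))" by (simp add: card_image)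
    also have "\<dots> = N - card (?A \<union> ?B)" by (subst card_Diff_subset) auto
    also have "card (?A \<union> ?B) = card ?A + card ?B"
      using cyc by (intro card_Un_disjoint) fastforce+
    also have "card ?A = n" unfolding N_def using assms(2) by (intro card_residue_class) simp
    also have "card ?B = 2"
    proof -
      consider "v = 0" | "Suc v = N" | "v > 0" "Suc v < N" using v by fastforce
      then obtain x y where "?B = {x, y}" "x \<noteq> y"
      proof cases
        case 1
        then have "?B = {1, N - 1}" using N3 by (auto simp: cyclic_adjacent_def)
        then show ?thesis using that[of 1 "N - 1"] N3 by simp
      next
        case 2
        then have "?B = {0, v - 1}" using N3 by (auto simp: cyclic_adjacent_def)
        then show ?thesis using that[of 0 "v - 1"] 2 N3 by simp
      next
        case 3
        then have "?B = {v - 1, v + 1}" by (auto simp: cyclic_adjacent_def)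
        then show ?thesis using that[of "v - 1" "v + 1"] by simp
      qed
      then show ?thesis by simp
    qed
    finally show ?thesis using Nh by simp
  qed
  \<comment> \<open>This is \<open>s + t mod N\<close> shifted into \<open>1\<close> to
    \<open>N\<close>. The ends are distinct, so \<open>\<Sum>e\<close> is really
    \<open>s + t\<close>, and it is less than \<open>2 * N\<close>, so one subtraction of
    \<open>N\<close> suffices.\<close>
  define c0 where "c0 = (\<lambda>e :: nat set. if \<Sum>e < N then Suc (\<Sum>e) else Suc (\<Sum>e) - N)"
  have c0: "proper_edge_coloring R c0"
    unfolding proper_edge_coloring_def
  proof (intro conjI ballI impI)
    fix e assume "e \<in> R"
    then show "0 < c0 e" by (auto simp: c0_def)
  next
    fix e f assume e: "e \<in> R" and f: "f \<in> R" and ef: "e \<noteq> f \<and> e \<inter> f \<noteq> {}"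
    then obtain v where v: "v \<in> e" "v \<in> f" by blast
    obtain s t where st: "e = {v, s}" "f = {v, t}" using Rvform e f v by metis
    moreover have "s < N" "t < N" "v < N" "v mod r \<noteq> s mod r" "v mod r \<noteq> t mod r"
      using Req e f st by auto
    moreover from this have "v \<noteq> s" "v \<noteq> t" by auto
    moreover have "s \<noteq> t" using st ef by auto
    ultimately show "c0 e \<noteq> c0 f" by (auto simp: c0_def)
  qed
  have c0r: "c0 ` R \<subseteq> {1..card {..<N}}"
  proof
    fix k assume "k \<in> c0 ` R"
    then obtain e where e: "e \<in> R" "k = c0 e" by blast
    then obtain s t where "e = {s, t}" "s < N" "t < N" "s \<noteq> t" using Rform by blast
    then show "k \<in> {1..card {..<N}}" using e by (auto simp: c0_def)
  qed
  have "\<exists>c. proper_edge_coloring (R \<union> {{v, q} |v q. v \<in> {..<N} \<and> q \<in> {N..<N + n + 2}}) c \<and>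
      c ` (R \<union> {{v, q} |v q. v \<in> {..<N} \<and> q \<in> {N..<N + n + 2}}) \<subseteq> {1..card {..<N}}"
  proof (rule regular_coloring_extends_to_join[OF _ _ _ deg c0 c0r])
    show "e \<subseteq> {..<N} \<and> card e = 2" if "e \<in> R" for e using Rform[OF that] by auto
    show "card {..<N} = card {N..<N + n + 2} + 2 * h" using Nh by simp
  qed (use N3 in \<open>auto simp: lessThan_empty_iff\<close>)
  then obtain c where c: "proper_edge_coloring (R \<union> outer_edges n r) c"
      "c ` (R \<union> outer_edges n r) \<subseteq> {1..N}"
    by (auto simp: outer_edges_def N_def)
  obtain x where x: "proper_edge_coloring (cycle_edges N) x"
      "x ` cycle_edges N \<subseteq> {N + 1..N + 3}"
    using cycle_edges_coloring[OF N3] by blast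
  \<comment> \<open>Cycle edges use colors above \<open>N\<close> and all other edges colors up to
    \<open>N\<close>, so the two colorings cannot conflict.\<close>
  define \<alpha> where "\<alpha> = (\<lambda>e. if e \<in> cycle_edges N then x e else c e)"
  have un: "inner_edges n r \<union> outer_edges n r = (R \<union> outer_edges n r) \<union> cycle_edges N"
    using XI by (auto simp: R_def)
  have big: "\<alpha> e \<in> {N + 1..N + 3}" if "e \<in> cycle_edges N" for e
    using that x(2) by (auto simp: \<alpha>_def)
  have small: "\<alpha> e \<in> {1..N}" if "e \<in> R \<union> outer_edges n r" "e \<notin> cycle_edges N" for e
    using that c(2) by (auto simp: \<alpha>_def)
  have outer: "e \<notin> cycle_edges N" if "e \<in> outer_edges n r" for e
    using that by (auto simp: outer_edges_def cycle_edges_def N_def doubleton_eq_iff)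
  have "proper_edge_coloring (inner_edges n r \<union> outer_edges n r) \<alpha>"
    unfolding proper_edge_coloring_def un
  proof (intro conjI ballI impI)
    fix e assume "e \<in> (R \<union> outer_edges n r) \<union> cycle_edges N"
    then show "0 < \<alpha> e" using big[of e] small[of e] by fastforce
  next
    fix e f assume e: "e \<in> (R \<union> outer_edges n r) \<union> cycle_edges N"
      and f: "f \<in> (R \<union> outer_edges n r) \<union> cycle_edges N" and ef: "e \<noteq> f \<and> e \<inter> f \<noteq> {}"
    show "\<alpha> e \<noteq> \<alpha> f"
    proof (cases "e \<in> cycle_edges N \<longleftrightarrow> f \<in> cycle_edges N")
      case True
      then show ?thesis
        using e f ef c(1) x(1) unfolding proper_edge_coloring_def \<alpha>_def by (metis UnE)
    next
      case False
      then show ?thesis using e f big[of e] big[of f] small[of e] small[of f] by fastforce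
    qed
  qed
  moreover have "\<alpha> ` outer_edges n r \<subseteq> {1..n * r}"
    using small outer by (auto simp: N_def)
  moreover have "\<alpha> e \<in> {1..n * r + 3}" if "e \<in> inner_edges n r" for e
    using big[of e] small[of e] that by (cases "e \<in> cycle_edges N") (auto simp: R_def N_def)
  ultimately show ?thesis by blast
qed

section \<open>Transfer to an arbitrary complete multipartite graph\<close>

lemma complete_multipartite_degree:
  assumes "complete_multipartite V E P" and "X \<in> P" and "v \<in> X"
  shows "card {e \<in> E. v \<in> e} = card V - card X"
proof -
  note cm = assms(1)[unfolded complete_multipartite_def simple_graph_def]
  have G: "e \<subseteq> V \<and> card e = 2" if "e \<in> E" for e using cm that by simp
  have finV: "finite V" and part: "partition_on V P" using cm by simp_all
  have no: "{u, v} \<notin> E" if "X \<in> P" "u \<in> X" "v \<in> X" for X u v using cm that by simp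
  have yes: "{u, v} \<in> E" if "X \<in> P" "Y \<in> P" "X \<noteq> Y" "u \<in> X" "v \<in> Y" for X Y u v
    using cm that by simp
  have V: "V = \<Union>P" using part by (simp add: partition_on_def)
  have "{e \<in> E. v \<in> e} = (\<lambda>u. {v, u}) ` (V - X)"
  proof (intro equalityI subsetI)
    fix e assume e: "e \<in> {e \<in> E. v \<in> e}"
    then have "card e = 2" using G by blast
    then obtain x y where "e = {x, y}" by (auto simp: card_2_iff)
    then obtain u where u: "e = {v, u}" using e by auto
    have "u \<in> V" using G[of e] e u by auto
    moreover have "u \<notin> X" using no[OF assms(2,3), of u] e u by auto
    ultimately show "e \<in> (\<lambda>u. {v, u}) ` (V - X)" using u by blast
  next
    fix e assume "e \<in> (\<lambda>u. {v, u}) ` (V - X)"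
    then obtain u where u: "e = {v, u}" "u \<in> V" "u \<notin> X" by blast
    then obtain Y where "Y \<in> P" "u \<in> Y" using V by blast
    then show "e \<in> {e \<in> E. v \<in> e}" using u yes[OF assms(2), of Y v u] assms(3) by auto
  qed
  moreover have "inj_on (\<lambda>u. {v, u}) (V - X)" by (auto simp: inj_on_def doubleton_eq_iff)
  moreover have "X \<subseteq> V" using V assms(2) by blast
  ultimately show ?thesis
    using finV by (simp add: card_image card_Diff_subset finite_subset)
qed

text \<open>The vertex at position \<open>i\<close> of the part with index \<open>k\<close> gets the
  number \<open>i * r + k\<close>: the residue mod \<open>r\<close> recovers the part and the
  quotient the position. The vertices of \<open>Q\<close> are numbered from \<open>n * r\<close>
  on.\<close>

lemma complete_multipartite_embedding:
  assumes cm: "complete_multipartite V E P" and P: "card P = r + 1" "Q \<in> P"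
    and Q: "card Q = n + 2" and n: "\<forall>X\<in>P - {Q}. card X = n"
  obtains f where "inj_on f V"
    and "\<And>v. v \<in> V - Q \<Longrightarrow> f v < n * r" and "\<And>v. v \<in> Q \<Longrightarrow> f v \<in> {n * r..<n * r + n + 2}"
    and "\<And>e. e \<in> E \<Longrightarrow> e \<inter> Q = {} \<Longrightarrow> f ` e \<in> inner_edges n r"
    and "\<And>e. e \<in> E \<Longrightarrow> e \<inter> Q \<noteq> {} \<Longrightarrow> f ` e \<in> outer_edges n r"
proof -
  note cm' = cm[unfolded complete_multipartite_def simple_graph_def]
  have G: "e \<subseteq> V \<and> card e = 2" if "e \<in> E" for e using cm' that by simp
  have finV: "finite V" and part: "partition_on V P" using cm' by simp_all
  have no: "{u, v} \<notin> E" if "X \<in> P" "u \<in> X" "v \<in> X" for X u v using cm' that by simp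
  have V: "V = \<Union>P" using part by (simp add: partition_on_def)
  have dis: "X = Y" if "X \<in> P" "Y \<in> P" "v \<in> X" "v \<in> Y" for X Y v
    using part that unfolding partition_on_def disjoint_def by blast
  have finP: "finite P" using P(1) by (metis Suc_eq_plus1 card.infinite nat.distinct(1))
  have finX: "finite X" if "X \<in> P" for X using that V finV by (metis Sup_upper finite_subset)
  have "card (P - {Q}) = card {..<r}" using P finP by simp
  then obtain g where g: "bij_betw g (P - {Q}) {..<r}"
    using finite_same_card_bij[of "P - {Q}" "{..<r}"] finP by auto
  have "\<forall>X\<in>P - {Q}. \<exists>h. bij_betw h X {..<n}"
    using n finX by (auto intro!: finite_same_card_bij)
  then obtain h where h: "\<And>X. X \<in> P - {Q} \<Longrightarrow> bij_betw (h X) X {..<n}" by metis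
  obtain j where j: "bij_betw j Q {..<n + 2}"
    using finite_same_card_bij[of Q "{..<n + 2}"] finX P(2) Q by auto
  have "\<forall>v\<in>V. \<exists>X. X \<in> P \<and> v \<in> X" using V by blast
  then obtain p where p: "\<And>v. v \<in> V \<Longrightarrow> p v \<in> P \<and> v \<in> p v" by metis
  have pQ: "p v \<in> P - {Q}" if "v \<in> V - Q" for v using p[of v] that by auto
  have gr: "g (p v) < r" if "v \<in> V - Q" for v
    using bij_betw_apply[OF g pQ[OF that]] by simp
  have hn: "h (p v) v < n" if "v \<in> V - Q" for v
    using bij_betw_apply[OF h[OF pQ[OF that]]] p[of v] that by auto
  define f where "f = (\<lambda>v. if v \<in> Q then n * r + j v else h (p v) v * r + g (p v))"
  have fW: "f v < n * r" and fmod: "f v mod r = g (p v)" and fdiv: "f v div r = h (p v) v"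
    if v: "v \<in> V - Q" for v
  proof -
    have f: "f v = h (p v) v * r + g (p v)" using v by (simp add: f_def)
    have "Suc (h (p v) v) * r \<le> n * r" using hn[OF v] by (intro mult_le_mono) auto
    then show "f v < n * r" using gr[OF v] f by simp
    show "f v mod r = g (p v)" "f v div r = h (p v) v" using gr[OF v] f by simp_all
  qed
  have fQ: "f v \<in> {n * r..<n * r + n + 2}" if "v \<in> Q" for v
    using bij_betw_apply[OF j that] that by (simp add: f_def)
  have inj: "inj_on f V"
  proof (rule inj_onI)
    fix u v assume u: "u \<in> V" and v: "v \<in> V" and eq: "f u = f v"
    have "u \<in> Q \<longleftrightarrow> v \<in> Q" using fQ[of u] fQ[of v] fW[of u] fW[of v] u v eq by fastforce
    then consider "u \<in> Q" "v \<in> Q" | "u \<in> V - Q" "v \<in> V - Q" using u v by blast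
    then show "u = v"
    proof cases
      case 1
      then have "j u = j v" using eq by (simp add: f_def)
      then show ?thesis using j 1 by (metis bij_betw_imp_inj_on inj_onD)
    next
      case 2
      have "g (p u) = g (p v)" using fmod[OF 2(1)] fmod[OF 2(2)] eq by simp
      then have pp: "p u = p v"
        using g pQ[OF 2(1)] pQ[OF 2(2)] by (metis bij_betw_imp_inj_on inj_onD)
      then have "h (p u) u = h (p u) v" using fdiv[OF 2(1)] fdiv[OF 2(2)] eq by simp
      then show ?thesis using h[OF pQ[OF 2(1)]] p[OF u] p[OF v] pp
        by (metis bij_betw_imp_inj_on inj_onD)
    qed
  qed
  have edge: "\<exists>u v. e = {u, v} \<and> u \<in> V \<and> v \<in> V \<and> p u \<noteq> p v" if e: "e \<in> E" for e
  proof -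
    obtain u v where uv: "e = {u, v}" using G[OF e] by (auto simp: card_2_iff)
    then have "u \<in> V" "v \<in> V" using G[OF e] by auto
    moreover from this have "p u \<noteq> p v" using no[of "p u" u v] p[of u] p[of v] e uv by metis
    ultimately show ?thesis using uv by blast
  qed
  have inner: "f ` e \<in> inner_edges n r" if eE: "e \<in> E" and eQ: "e \<inter> Q = {}" for e
  proof -
    obtain u v where e: "e = {u, v}" "p u \<noteq> p v" and uv: "u \<in> V - Q" "v \<in> V - Q"
      using edge[OF eE] eQ by blast
    have "g (p u) \<noteq> g (p v)"
      using e(2) g pQ[OF uv(1)] pQ[OF uv(2)] by (metis bij_betw_imp_inj_on inj_onD)
    then show ?thesis unfolding inner_edges_def
      by (intro CollectI exI[of _ "f u"] exI[of _ "f v"]) (simp add: e(1) fW[OF uv(1)] fW[OF uv(2)] fmod[OF uv(1)] fmod[OF uv(2)])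
  qed
  have outer: "f ` e \<in> outer_edges n r" if eE: "e \<in> E" and eQ: "e \<inter> Q \<noteq> {}" for e
  proof -
    \<comment> \<open>\<open>p\<close> is constant on \<open>Q\<close>, so an edge meeting
      \<open>Q\<close> has exactly one end there.\<close>
    have pQQ: "p q = Q" if "q \<in> Q" "q \<in> V" for q using dis[of "p q" Q q] p[of q] P(2) that by blast
    obtain u v where e: "e = {u, v}" "u \<in> V" "v \<in> V" "p u \<noteq> p v" using edge[OF eE] by blast
    have "\<exists>u q. e = {u, q} \<and> u \<in> V - Q \<and> q \<in> Q"
    proof (cases "u \<in> Q")
      case True
      then have "v \<notin> Q" using e pQQ by metis
      then show ?thesis using True e by (intro exI[of _ v] exI[of _ u]) auto
    next
      case False
      then show ?thesis using eQ e by (intro exI[of _ u] exI[of _ v]) auto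
    qed
    then obtain u q where "e = {u, q}" "u \<in> V - Q" "q \<in> Q" by blast
    then show ?thesis unfolding outer_edges_def
      by (intro CollectI exI[of _ "f u"] exI[of _ "f q"]) (use fW fQ in simp)
  qed
  show thesis using that inj fW fQ inner outer by blast
qed

text \<open>Injectivity on \<open>V\<close> keeps distinct edges distinct, and images of
  intersecting edges intersect.\<close>

lemma proper_edge_coloring_pullback:
  assumes "proper_edge_coloring E' \<alpha>" and "inj_on f V"
    and "\<And>e. e \<in> E \<Longrightarrow> e \<subseteq> V" and "\<And>e. e \<in> E \<Longrightarrow> f ` e \<in> E'"
  shows "proper_edge_coloring E (\<lambda>e. \<alpha> (f ` e))"
  unfolding proper_edge_coloring_def
proof (intro conjI ballI impI)
  fix e assume "e \<in> E"
  then show "0 < \<alpha> (f ` e)" using assms(1,4) by (simp add: proper_edge_coloring_def)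
next
  fix e g assume e: "e \<in> E" and g: "g \<in> E" and eg: "e \<noteq> g \<and> e \<inter> g \<noteq> {}"
  have "f ` e \<noteq> f ` g" using eg assms(3)[OF e] assms(3)[OF g] assms(2)
    by (simp add: inj_on_image_eq_iff)
  moreover have "f ` e \<inter> f ` g \<noteq> {}" using eg by blast
  ultimately show "\<alpha> (f ` e) \<noteq> \<alpha> (f ` g)"
    using assms(1,4) e g unfolding proper_edge_coloring_def by metis
qed

section \<open>Total deficiency for \<open>r = 1\<close> and for \<open>r \<ge> 2\<close>\<close>

theorem theorem11:
  fixes V :: "'a set" and E :: "'a set set" and P :: "'a set set" and Q :: "'a set"
    and n r :: nat
  assumes "n > 0" and "r > 0" and "even (n * (r + 1))"
    and "complete_multipartite V E P"
    and "card P = r + 1"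
    and "Q \<in> P" and "card Q = n + 2"
    and "\<forall>X\<in>P - {Q}. card X = n"
  shows "deficiency V E \<le> n * r + 2"
proof -
  obtain f where inj: "inj_on f V"
    and fW: "\<And>v. v \<in> V - Q \<Longrightarrow> f v < n * r"
    and fQ: "\<And>v. v \<in> Q \<Longrightarrow> f v \<in> {n * r..<n * r + n + 2}"
    and inner: "\<And>e. e \<in> E \<Longrightarrow> e \<inter> Q = {} \<Longrightarrow> f ` e \<in> inner_edges n r"
    and outer: "\<And>e. e \<in> E \<Longrightarrow> e \<inter> Q \<noteq> {} \<Longrightarrow> f ` e \<in> outer_edges n r"
    by (rule complete_multipartite_embedding[OF assms(4-8)]) metis
  have simple: "simple_graph V E" and part: "partition_on V P"
    using assms(4) by (auto simp: complete_multipartite_def)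
  have finE: "finite E" using simple by (rule simple_graph_finite_edges)
  have finV: "finite V" and sub: "\<And>e. e \<in> E \<Longrightarrow> e \<subseteq> V"
    using simple by (auto simp: simple_graph_def)
  have V: "V = \<Union>P" using part by (simp add: partition_on_def)
  have finP: "finite P" using assms(5) by (metis Suc_eq_plus1 card.infinite nat.distinct(1))
  have QV: "Q \<subseteq> V" using V assms(6) by blast
  have "card V = (\<Sum>X\<in>P. card X)"
    unfolding V using part finV V
    by (intro card_Union_disjoint) (auto simp: partition_on_def intro: finite_subset)
  also have "\<dots> = card Q + (\<Sum>X\<in>P - {Q}. card X)" using finP assms(6) by (rule sum.remove)
  also have "(\<Sum>X\<in>P - {Q}. card X) = (\<Sum>X\<in>P - {Q}. n)" by (rule sum.cong) (use assms(8) in auto)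
  also have "\<dots> = n * r" using finP assms(5,6) by simp
  finally have cV: "card V = n * r + n + 2" using assms(7) by simp
  have degW: "card {e \<in> E. v \<in> e} = n * r + 2" if v: "v \<in> V - Q" for v
  proof -
    obtain X where "X \<in> P" "v \<in> X" "X \<noteq> Q" using V v by blast
    then show ?thesis using complete_multipartite_degree[OF assms(4), of X v] assms(8) cV by simp
  qed
  have degQ: "card {e \<in> E. v \<in> e} = n * r" if "v \<in> Q" for v
    using complete_multipartite_degree[OF assms(4,6) that] assms(7) cV by simp
  show ?thesis
  proof (cases "r = 1")
    case True
    have inner1: "inner_edges n r = {}" using True by (auto simp: inner_edges_def)
    \<comment> \<open>For \<open>r = 1\<close> the numbers of \<open>Q\<close> start at
      \<open>n\<close>; subtracting \<open>n\<close> makes the colors start at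
      \<open>1\<close>.\<close>
    define \<alpha>0 where "\<alpha>0 = (\<lambda>e :: nat set. Suc (\<Sum>e) - n)"
    have \<alpha>0: "\<alpha>0 {s, q} = s + (q - n) + 1" if "s < n" "n \<le> q" for s q
      using that by (simp add: \<alpha>0_def)
    have "proper_edge_coloring (outer_edges n r) \<alpha>0"
      unfolding proper_edge_coloring_def
    proof (intro conjI ballI impI)
      fix e assume "e \<in> outer_edges n r"
      then show "0 < \<alpha>0 e" using \<alpha>0 True by (auto simp: outer_edges_def)
    next
      fix e g assume "e \<in> outer_edges n r" "g \<in> outer_edges n r" and eg: "e \<noteq> g \<and> e \<inter> g \<noteq> {}"
      then obtain s q s' q' where *: "e = {s, q}" "s < n" "n \<le> q" "g = {s', q'}" "s' < n" "n \<le> q'"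
        using True by (auto simp: outer_edges_def)
      then have "s = s' \<and> q \<noteq> q' \<or> s \<noteq> s' \<and> q = q'" using eg by auto
      then show "\<alpha>0 e \<noteq> \<alpha>0 g" using * \<alpha>0 by auto
    qed
    moreover have fout: "f ` e \<in> outer_edges n r" if "e \<in> E" for e
      using inner[OF that] outer[OF that] inner1 by blast
    ultimately have p: "proper_edge_coloring E (\<lambda>e. \<alpha>0 (f ` e))"
      using proper_edge_coloring_pullback[OF _ inj sub] by blast
    have "vertex_deficiency E (\<lambda>e. \<alpha>0 (f ` e)) v = 0" if v: "v \<in> V" for v
    proof -
      have ex: "\<exists>s q. f ` e = {s, q} \<and> s < n \<and> n \<le> q \<and> q < 2 * n + 2 \<and> (f v = s \<or> f v = q)"
        if "e \<in> E" "v \<in> e" for e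
        using fout[OF that(1)] imageI[OF that(2), of f] True by (fastforce simp: outer_edges_def)
      show ?thesis
      proof (cases "v \<in> Q")
        case True
        \<comment> \<open>At a vertex of \<open>Q\<close> the other end runs over \<open>n\<close>
          consecutive numbers, as many as the degree.\<close>
        have "\<alpha>0 (f ` e) \<in> {f v - n + 1..f v - n + n}" if e: "e \<in> E" "v \<in> e" for e
        proof -
          obtain s q where sq: "f ` e = {s, q}" "s < n" "n \<le> q" "f v = s \<or> f v = q"
            using ex[OF e] by blast
          then have "f v = q" using fQ[OF True] \<open>r = 1\<close> by auto
          then show ?thesis using sq \<alpha>0[of s q] by auto
        qed
        from vertex_deficiency_le[of E _ v, OF p finE this] show ?thesis
          using degQ[OF True] \<open>r = 1\<close> by simp
      next
        case False
        \<comment> \<open>Outside \<open>Q\<close> the other end runs over \<open>n + 2\<close>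
          consecutive numbers, again the degree.\<close>
        have "\<alpha>0 (f ` e) \<in> {f v + 1..f v + n + 2}" if e: "e \<in> E" "v \<in> e" for e
        proof -
          obtain s q where sq: "f ` e = {s, q}" "s < n" "n \<le> q" "q < 2 * n + 2" "f v = s \<or> f v = q"
            using ex[OF e] by blast
          then have "f v = s" using fW[of v] v False \<open>r = 1\<close> by auto
          then show ?thesis using sq \<alpha>0 by auto
        qed
        from vertex_deficiency_le[of E _ v, OF p finE this] show ?thesis
          using degW[of v] v False \<open>r = 1\<close> by simp
      qed
    qed
    then have "(\<Sum>v\<in>V. vertex_deficiency E (\<lambda>e. \<alpha>0 (f ` e)) v) = 0" by simp
    then show ?thesis using deficiency_le[OF p, of V] by simp
  next
    case False
    then have "r \<ge> 2" using assms(2) by simp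
    then obtain \<alpha>0 where \<alpha>0: "proper_edge_coloring (inner_edges n r \<union> outer_edges n r) \<alpha>0"
        "\<alpha>0 ` inner_edges n r \<subseteq> {1..n * r + 3}" "\<alpha>0 ` outer_edges n r \<subseteq> {1..n * r}"
      using canonical_coloring[OF assms(1) _ assms(3)] by blast
    have p: "proper_edge_coloring E (\<lambda>e. \<alpha>0 (f ` e))"
      using inner outer by (intro proper_edge_coloring_pullback[OF \<alpha>0(1) inj sub]) blast+
    have rangeQ: "\<alpha>0 (f ` e) \<in> {1..n * r}" if "e \<in> E" "e \<inter> Q \<noteq> {}" for e
      using outer[OF that] \<alpha>0(3) by blast
    have range: "\<alpha>0 (f ` e) \<in> {1..n * r + 3}" if "e \<in> E" for e
    proof (cases "e \<inter> Q = {}")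
      case True
      then show ?thesis using inner[OF that] \<alpha>0(2) by blast
    next
      case False
      then show ?thesis using rangeQ[OF that] by simp
    qed
    have "vertex_deficiency E (\<lambda>e. \<alpha>0 (f ` e)) v \<le> (if v \<in> Q then 0 else 1)" if v: "v \<in> V" for v
    proof (cases "v \<in> Q")
      case True
      have "\<alpha>0 (f ` e) \<in> {1..n * r}" if "e \<in> E" "v \<in> e" for e
        using rangeQ[OF that(1)] that(2) True by blast
      from vertex_deficiency_le[of E _ v, OF p finE this] show ?thesis using degQ[OF True] True by simp
    next
      case False
      have "\<alpha>0 (f ` e) \<in> {1..n * r + 3}" if "e \<in> E" "v \<in> e" for e
        using that(1) by (rule range)
      from vertex_deficiency_le[of E _ v, OF p finE this] show ?thesis using degW[of v] v False by simp
    qed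
    then have "(\<Sum>v\<in>V. vertex_deficiency E (\<lambda>e. \<alpha>0 (f ` e)) v) \<le> (\<Sum>v\<in>V. if v \<in> Q then 0 else 1)"
      by (rule sum_mono)
    also have "\<dots> = card (V - Q)"
      using finV by (simp add: sum.If_cases Diff_eq)
    also have "\<dots> = n * r"
      using cV assms(7) QV finV by (simp add: card_Diff_subset finite_subset)
    \<comment> \<open>The coloring has total deficiency at most \<open>n * r\<close>, two below the
      claimed bound.\<close>
    finally show ?thesis using deficiency_le[OF p, of V] by linarith
  qed
qed

end
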